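(* Let $p$ be a prime, let $K\subset\mathbb{Q}_p$ be a field with $[K:\mathbb{Q}]=3$ (so $s=2$), and let $z\in K$ satisfy condition (H), with $K=\mathbb{Q}(z)$ and $z$ integral over $\mathbb{Z}$, having minimal polynomial $x^3+a_1x^2+a_2x+a_3p^k$ with $a_1,a_2,a_3\in\mathbb{Z}$, $\mathrm{ord}_p(a_2)=\mathrm{ord}_p(a_3)=0$ and $k\in\mathbb{Z}_{>0}$. Let $\epsilon\in\{-1,1\}$. Then $\bar\alpha=(z,z^2)^T$ has a periodic expansion under the map $T=T_{\epsilon,z}:K^2\to K^2$ defined in the context, i.e. $T^{m_1}(\bar\alpha)=T^{m_2}(\bar\alpha)$ for some integers $0\le m_1<m_2$.
   Context: Notation: For $\beta\in\mathbb{Q}_p\setminus\{0\}$ write $\beta=\sum_{n\in\mathbb{Z}}c_np^n$ with digits $c_n\in\{0,\dots,p-1\}$; $\mathrm{ord}_p(\beta)=\min\{n:c_n\ne0\}$ ($\mathrm{ord}_p(0)=\infty$), $\omega_p(\beta):=c_0$ ($\omega_p(0)=0$), $\langle\beta\rangle_p:=\sum_{n\ge1}c_np^n$ ($\langle0\rangle_p=0$). Condition (H): an element $\beta\in\mathbb{Q}_p$, algebraic over $\mathbb{Q}$, with $\beta\notin\mathbb{Q}$ and $\beta\in p\mathbb{Z}_p$, satisfies (H) if its minimal polynomial over $\mathbb{Q}$ is $x^n+b_1x^{n-1}+\dots+b_n$ with all $b_i\in\mathbb{Z}_p\cap\mathbb{Q}$, $\mathrm{ord}_p(b_{n-1})=0$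 and $\mathrm{ord}_p(b_n)>0$. The map $T=T_{\epsilon,z}$ on $K^s$ (the $\Phi_1^{[\epsilon,z]}$ algorithm, here $s=2$): for $\bar\alpha=(\alpha_1,\dots,\alpha_s)^T\in K^s$ define $g_1,\dots,g_s\in K$ as follows. If $\alpha_1\ne0$: $g_1=\frac{\epsilon p^{\mathrm{ord}_p(\alpha_1)}}{\alpha_1}-\omega_p\!\left(\frac{\epsilon p^{\mathrm{ord}_p(\alpha_1)}}{\alpha_1}\right)$ and, for $i\ne1$, $g_i=\frac{\epsilon p^{k_i}\alpha_i}{\alpha_1}-\omega_p\!\left(\frac{\epsilon p^{k_i}\alpha_i}{\alpha_1}\right)$ with $k_i=\max\{\mathrm{ord}_p(\alpha_1)-\mathrm{ord}_p(\alpha_i),0\}$. If $\alpha_1=0$: $g_i=\alpha_i$ for all $i$. Write uniquely $g_i=\sum_{j=0}^s a_{ij}z^j$ with $a_{ij}\in\mathbb{Q}$, let $a'_i$ be the largest positive integer coprime to $p$ dividing the numerators of all of $a_{i1},\dots,a_{is}$ ($a'_i=1$ if these all vanish), and put $h_i=\frac{g_i}{a'_i}-\left\langle\frac{a_{i0}}{a'_i}\right\rangle_p$. Then $T(\bar\alpha):=(h_2,h_3,\dots,h_s,h_1)^T$ (cyclic shift). *)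

theory Defs
  imports
    "HOL-Computational_Algebra.Computational_Algebra"
    "HOL-Library.Extended"
    "Berlekamp_Zassenhaus.Finite_Field"
begin

section \<open>The field of p-adic numbers\<close>

text \<open>The prime is \<^term>\<open>CARD('p)\<close> for a type \<open>'p\<close> of prime cardinality. A p-adic integer is a
  coherent sequence of residues, i.e. an element of the inverse limit of the rings of integers
  modulo the powers of p; each residue is represented by its least nonnegative representative.\<close>

typedef (overloaded) 'p padic_int =
  "{x :: nat \<Rightarrow> int. \<forall>n. x n = x (Suc n) mod int CARD('p::prime_card) ^ n}"
  morphisms residue Abs_padic_int
  by (rule exI[of _ "\<lambda>_. 0"]) simp

setup_lifting type_definition_padic_int

lemma residue_Suc_mod:
  "residue (x :: 'p::prime_card padic_int) (Suc n) mod int CARD('p) ^ n = residue x n"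
  using residue[of x] unfolding mem_Collect_eq by metis

lemma residue_mod [simp]:
  "residue (x :: 'p::prime_card padic_int) n mod int CARD('p) ^ n = residue x n"
  by (metis residue_Suc_mod mod_mod_trivial)

lemma padic_int_eqI: "(\<And>n. residue x n = residue y n) \<Longrightarrow> x = y"
  by (metis ext residue_inject)

context
  fixes x y :: "nat \<Rightarrow> int" and q :: int
  assumes x: "\<And>n. x n = x (Suc n) mod q ^ n" and y: "\<And>n. y n = y (Suc n) mod q ^ n"
begin

lemma coherent_add: "(x n + y n) mod q ^ n = (x (Suc n) + y (Suc n)) mod q ^ Suc n mod q ^ n"
proof -
  have "(x (Suc n) + y (Suc n)) mod q ^ Suc n mod q ^ n = (x (Suc n) + y (Suc n)) mod q ^ n"
    by (rule mod_mod_cancel) simp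
  thus "(x n + y n) mod q ^ n = (x (Suc n) + y (Suc n)) mod q ^ Suc n mod q ^ n"
    using x[of n] y[of n] by (metis mod_add_eq)
qed

lemma coherent_diff: "(x n - y n) mod q ^ n = (x (Suc n) - y (Suc n)) mod q ^ Suc n mod q ^ n"
proof -
  have "(x (Suc n) - y (Suc n)) mod q ^ Suc n mod q ^ n = (x (Suc n) - y (Suc n)) mod q ^ n"
    by (rule mod_mod_cancel) simp
  thus "(x n - y n) mod q ^ n = (x (Suc n) - y (Suc n)) mod q ^ Suc n mod q ^ n"
    using x[of n] y[of n] by (metis mod_diff_eq)
qed

lemma coherent_mult: "(x n * y n) mod q ^ n = (x (Suc n) * y (Suc n)) mod q ^ Suc n mod q ^ n"
proof -
  have "(x (Suc n) * y (Suc n)) mod q ^ Suc n mod q ^ n = (x (Suc n) * y (Suc n)) mod q ^ n"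
    by (rule mod_mod_cancel) simp
  thus "(x n * y n) mod q ^ n = (x (Suc n) * y (Suc n)) mod q ^ Suc n mod q ^ n"
    using x[of n] y[of n] by (metis mod_mult_eq)
qed

lemma coherent_uminus: "(- x n) mod q ^ n = (- x (Suc n)) mod q ^ Suc n mod q ^ n"
proof -
  have "(- x (Suc n)) mod q ^ Suc n mod q ^ n = (- x (Suc n)) mod q ^ n"
    by (rule mod_mod_cancel) simp
  thus "(- x n) mod q ^ n = (- x (Suc n)) mod q ^ Suc n mod q ^ n"
    using x[of n] by (metis mod_minus_eq)
qed

end

instantiation padic_int :: (prime_card) comm_ring_1
begin

lift_definition zero_padic_int :: "'a padic_int" is "\<lambda>_. 0" by simp

lift_definition one_padic_int :: "'a padic_int" is "\<lambda>n. 1 mod int CARD('a) ^ n"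
  by (simp add: mod_mod_cancel)

lift_definition plus_padic_int :: "'a padic_int \<Rightarrow> 'a padic_int \<Rightarrow> 'a padic_int"
  is "\<lambda>x y n. (x n + y n) mod int CARD('a) ^ n" by (rule coherent_add)

lift_definition uminus_padic_int :: "'a padic_int \<Rightarrow> 'a padic_int"
  is "\<lambda>x n. (- x n) mod int CARD('a) ^ n" by (rule coherent_uminus)

lift_definition minus_padic_int :: "'a padic_int \<Rightarrow> 'a padic_int \<Rightarrow> 'a padic_int"
  is "\<lambda>x y n. (x n - y n) mod int CARD('a) ^ n" by (rule coherent_diff)

lift_definition times_padic_int :: "'a padic_int \<Rightarrow> 'a padic_int \<Rightarrow> 'a padic_int"
  is "\<lambda>x y n. (x n * y n) mod int CARD('a) ^ n" by (rule coherent_mult)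

lemmas residue_simps =
  zero_padic_int.rep_eq one_padic_int.rep_eq plus_padic_int.rep_eq uminus_padic_int.rep_eq
  minus_padic_int.rep_eq times_padic_int.rep_eq

instance
proof
  fix a b c :: "'a padic_int"
  show "a * b * c = a * (b * c)"
    by (rule padic_int_eqI) (simp add: residue_simps mod_simps mult.assoc)
  show "a * b = b * a"
    by (rule padic_int_eqI) (simp add: residue_simps mult.commute)
  show "1 * a = a"
    by (rule padic_int_eqI) (simp add: residue_simps mod_simps)
  show "a + b + c = a + (b + c)"
    by (rule padic_int_eqI) (simp add: residue_simps mod_simps add.assoc)
  show "a + b = b + a"
    by (rule padic_int_eqI) (simp add: residue_simps add.commute)
  show "0 + a = a"
    by (rule padic_int_eqI) (simp add: residue_simps)
  show "- a + a = 0"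
    by (rule padic_int_eqI) (simp add: residue_simps mod_simps)
  show "a - b = a + - b"
    by (rule padic_int_eqI) (simp add: residue_simps mod_simps)
  show "(a + b) * c = a * c + b * c"
    by (rule padic_int_eqI) (simp add: residue_simps mod_simps distrib_right)
  have "CARD('a) > 1" using prime_card[where 'a='a] by (rule prime_gt_1_nat)
  hence "residue (0::'a padic_int) 1 \<noteq> residue 1 1"
    by (simp add: residue_simps)
  thus "(0::'a padic_int) \<noteq> 1" by metis
qed

end

lemma residue_of_nat: "residue (of_nat m :: 'p::prime_card padic_int) n = int m mod int CARD('p) ^ n"
  by (induction m) (simp_all add: residue_simps mod_simps add.commute)

lemma residue_of_int: "residue (of_int m :: 'p::prime_card padic_int) n = m mod int CARD('p) ^ n"
  by (cases m rule: int_cases2) (simp_all add: residue_simps residue_of_nat mod_simps)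

lemma residue_mod_le:
  assumes "m \<le> n"
  shows "residue (x :: 'p::prime_card padic_int) n mod int CARD('p) ^ m = residue x m"
  using assms
proof (induction n rule: dec_induct)
  case (step n)
  have "residue x (Suc n) mod int CARD('p) ^ m = residue x (Suc n) mod int CARD('p) ^ n mod int CARD('p) ^ m"
    using step.hyps by (simp add: mod_mod_cancel le_imp_power_dvd)
  thus ?case using step.IH by (simp add: residue_Suc_mod)
qed simp

instance padic_int :: (prime_card) idom
proof
  fix a b :: "'a padic_int"
  let ?p = "int CARD('a)"
  have prime: "prime ?p" using prime_card[where 'a='a] by simp
  assume "a \<noteq> 0" "b \<noteq> 0"
  then obtain m n where mn: "residue a m \<noteq> 0" "residue b n \<noteq> 0"
    by (metis padic_int_eqI zero_padic_int.rep_eq)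
  have "\<not> ?p ^ m dvd residue a (m + n)" "\<not> ?p ^ n dvd residue b (m + n)"
    using mn residue_mod_le[of m "m+n" a] residue_mod_le[of n "m+n" b]
    by (auto simp: dvd_eq_mod_eq_0)
  moreover have "(\<exists>i j. i + j = m + n \<and> ?p ^ i dvd x \<and> ?p ^ j dvd y)" if "?p ^ (m + n) dvd x * y" for x y
    using prime_elem_power_dvd_prod[OF that prime_imp_prime_elem[OF prime]] by metis
  moreover have "m \<le> i \<or> n \<le> j" if "i + j = m + n" for i j
    using that by linarith
  ultimately have "\<not> ?p ^ (m + n) dvd residue a (m + n) * residue b (m + n)"
    by (meson power_le_dvd)
  hence "residue (a * b) (m + n) \<noteq> 0"
    by (auto simp: residue_simps dvd_eq_mod_eq_0)
  thus "a * b \<noteq> 0" by (metis zero_padic_int.rep_eq)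
qed

instance padic_int :: (prime_card) ring_char_0
proof
  show "inj (of_nat :: nat \<Rightarrow> 'a padic_int)"
  proof (rule injI)
    fix m n assume eq: "(of_nat m :: 'a padic_int) = of_nat n"
    have p: "CARD('a) > 1" using prime_card[where 'a='a] by (rule prime_gt_1_nat)
    have "m < CARD('a) ^ (m + n)" "n < CARD('a) ^ (m + n)"
      using power_gt_expt[of "CARD('a)" "m + n"] p by simp_all
    moreover have "int m mod int CARD('a) ^ (m + n) = int n mod int CARD('a) ^ (m + n)"
      using eq by (metis residue_of_nat)
    hence "m mod CARD('a) ^ (m + n) = n mod CARD('a) ^ (m + n)"
      by (metis of_nat_eq_iff of_nat_mod of_nat_power)
    ultimately show "m = n" by simp
  qed
qed

instance fract :: ("{idom, ring_char_0}") field_char_0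
proof
  show "inj (of_nat :: nat \<Rightarrow> 'a fract)"
  proof (rule injI)
    fix m n assume "(of_nat m :: 'a fract) = of_nat n"
    hence "to_fract (of_nat m :: 'a) = to_fract (of_nat n)"
      unfolding to_fract_def of_nat_fract[symmetric] .
    thus "m = n" by (simp only: to_fract_eq_iff of_nat_eq_iff)
  qed
qed

type_synonym 'p padic = "'p padic_int fract"

abbreviation padic_p :: "'p::prime_card padic" where
  "padic_p \<equiv> of_nat CARD('p)"

definition padic_ints :: "'p::prime_card padic set" where
  "padic_ints = range to_fract"

subsection \<open>Digit expansions\<close>

text \<open>\<open>padic_series c \<beta>\<close>: the digit sequence \<open>c\<close> has only finitely many nonzero terms of negative
  index, and the partial sums of \<open>\<Sum>n. c n * p ^ n\<close> converge p-adically to \<open>\<beta>\<close>.\<close>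

definition padic_series :: "(int \<Rightarrow> nat) \<Rightarrow> 'p::prime_card padic \<Rightarrow> bool" where
  "padic_series c \<beta> \<longleftrightarrow>
     (\<forall>n. c n < CARD('p)) \<and> (\<exists>N. \<forall>n<N. c n = 0) \<and>
     (\<forall>k::nat. \<exists>M. \<forall>m\<ge>M. \<beta> - (\<Sum>n=-m..m. of_nat (c n) * padic_p powi n) \<in> (*) (padic_p ^ k) ` padic_ints)"

lemma CARD_prime_gt_1: "int CARD('p::prime_card) > 1"
  using prime_gt_1_nat[OF prime_card[where 'a='p]] by simp

lemma padic_p_nonzero [simp]: "(padic_p :: 'p::prime_card padic) \<noteq> 0"
  using CARD_prime_gt_1[where 'p='p] by simp

lemma padic_p_powi_mult_power:
  "(padic_p :: 'p::prime_card padic) powi a * padic_p ^ n = padic_p powi (a + int n)"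
  using power_int_add[of "padic_p :: 'p padic" a "int n"] by simp

lemma to_fract_of_nat: "to_fract (of_nat n) = of_nat n"
  by (induction n) simp_all

lemma to_fract_of_int: "to_fract (of_int n) = of_int n"
  by (cases n rule: int_cases2) (simp_all add: to_fract_of_nat)

lemma to_fract_power: "to_fract (x ^ n) = to_fract x ^ n"
  by (induction n) simp_all

lemma padic_ints_of_int [simp]: "of_int n \<in> padic_ints"
  unfolding padic_ints_def by (metis rangeI to_fract_of_int)

lemma padic_ints_of_nat [simp]: "of_nat n \<in> padic_ints"
  unfolding padic_ints_def by (metis rangeI to_fract_of_nat)

lemma padic_ints_diff: "x \<in> padic_ints \<Longrightarrow> y \<in> padic_ints \<Longrightarrow> x - y \<in> padic_ints"
  unfolding padic_ints_def by (auto simp flip: to_fract_diff)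

lemma padic_ints_mult: "x \<in> padic_ints \<Longrightarrow> y \<in> padic_ints \<Longrightarrow> x * y \<in> padic_ints"
  unfolding padic_ints_def by (auto simp flip: to_fract_mult)

lemma padic_ints_power: "x \<in> padic_ints \<Longrightarrow> x ^ n \<in> padic_ints"
  unfolding padic_ints_def by (auto simp flip: to_fract_power)

lemma padic_p_multiple_diff:
  "x \<in> (*) (padic_p ^ k) ` padic_ints \<Longrightarrow> y \<in> (*) (padic_p ^ k) ` padic_ints \<Longrightarrow>
    x - y \<in> (*) (padic_p ^ k) ` padic_ints"
  by (auto simp: right_diff_distrib[symmetric] intro: padic_ints_diff)

lemma residue_of_nat_power_mult:
  "residue (of_nat CARD('p) ^ k * x :: 'p::prime_card padic_int) k = 0"
proof -
  have "(of_nat CARD('p) :: 'p padic_int) ^ k = of_nat (CARD('p) ^ k)" by simp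
  hence "residue (of_nat CARD('p) ^ k :: 'p padic_int) k = 0"
    by (simp only: residue_of_nat) simp
  thus ?thesis by (simp add: residue_simps)
qed

lemma of_int_padic_p_multipleD:
  assumes "(of_int a :: 'p::prime_card padic) \<in> (*) (padic_p ^ k) ` padic_ints"
  shows "int CARD('p) ^ k dvd a"
proof -
  obtain x :: "'p padic_int" where "(of_int a :: 'p padic) = padic_p ^ k * to_fract x"
    using assms unfolding padic_ints_def by auto
  hence "to_fract (of_int a) = to_fract (of_nat CARD('p) ^ k * x)"
    by (simp only: to_fract_of_int to_fract_mult to_fract_power to_fract_of_nat)
  hence "of_int a = of_nat CARD('p) ^ k * x" by (simp only: to_fract_eq_iff)
  hence "residue (of_int a :: 'p padic_int) k = 0" by (metis residue_of_nat_power_mult)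
  thus ?thesis by (simp add: residue_of_int dvd_eq_mod_eq_0)
qed

lemma padic_int_residue_decomp:
  "\<exists>y. x = of_int (residue x n) + of_nat CARD('p) ^ n * (y :: 'p::prime_card padic_int)"
proof -
  let ?p = "int CARD('p)"
  define f where "f = (\<lambda>k. residue x (n + k) div ?p ^ n)"
  have pos: "?p > 0" by simp
  have coh: "f k = f (Suc k) mod ?p ^ k" for k
  proof -
    have "f (Suc k) mod ?p ^ k = (residue x (n + Suc k) mod (?p ^ n * ?p ^ k)) div ?p ^ n"
      unfolding f_def by (simp add: zmod_zmult2_eq)
    also have "residue x (n + Suc k) mod (?p ^ n * ?p ^ k) = residue x (n + k)"
      using residue_mod_le[of "n + k" "n + Suc k" x] by (simp add: power_add)
    finally show ?thesis by (simp add: f_def)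
  qed
  define y :: "'p padic_int" where "y = Abs_padic_int f"
  have y: "residue y = f"
    unfolding y_def by (rule Abs_padic_int_inverse) (use coh in blast)
  have pn: "(of_nat CARD('p) :: 'p padic_int) ^ n = of_int (?p ^ n)" by simp
  have "x = of_int (residue x n) + of_int (?p ^ n) * y"
  proof (rule padic_int_eqI)
    fix k
    have "residue (of_int a + of_int q * y) k = (a + q * f k) mod ?p ^ k" for a q
      by (simp add: plus_padic_int.rep_eq times_padic_int.rep_eq residue_of_int y mod_simps)
    hence "residue (of_int (residue x n) + of_int (?p ^ n) * y) k = (residue x n + ?p ^ n * f k) mod ?p ^ k" .
    also have "residue x n + ?p ^ n * f k = residue x (n + k)"
      using residue_mod_le[of n "n + k" x] by (metis f_def le_add1 mod_mult_div_eq)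
    also have "\<dots> mod ?p ^ k = residue x k" by (rule residue_mod_le) simp
    finally show "residue x k = residue (of_int (residue x n) + of_int (?p ^ n) * y) k" by simp
  qed
  thus ?thesis unfolding pn[symmetric] by blast
qed

lemma padic_int_unit:
  assumes "residue (u :: 'p::prime_card padic_int) 1 \<noteq> 0"
  shows "u dvd 1"
proof -
  let ?p = "int CARD('p)"
  have prime: "prime ?p" using prime_card[where 'a='p] by simp
  have cop: "coprime (residue u n) (?p ^ n)" for n
  proof (cases "n = 0")
    case False
    hence "residue u n mod ?p = residue u 1" using residue_mod_le[of 1 n u] by simp
    hence "\<not> ?p dvd residue u n" using assms by (simp add: dvd_eq_mod_eq_0)
    hence "coprime ?p (residue u n)" using prime by (simp add: prime_imp_coprime)
    thus ?thesis by (simp add: coprime_commute)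
  qed simp
  have "\<exists>z. [residue u n * z = 1] (mod ?p ^ n)" for n
    using cop[of n] by (rule cong_solve_coprime_int)
  then obtain z where z: "\<And>n. [residue u n * z n = 1] (mod ?p ^ n)" by metis
  define f where "f = (\<lambda>n. z n mod ?p ^ n)"
  have f: "[residue u n * f n = 1] (mod ?p ^ n)" for n
    using z[of n] unfolding f_def cong_def by (simp add: mod_simps)
  have "f n = f (Suc n) mod ?p ^ n" for n
  proof -
    have "[residue u (Suc n) * f (Suc n) = 1] (mod ?p ^ n)"
      using f[of "Suc n"] by (rule cong_dvd_modulus) simp
    hence "[residue u n * f (Suc n) = 1] (mod ?p ^ n)"
      unfolding cong_def by (metis residue_Suc_mod mod_mult_left_eq)
    hence "[residue u n * f (Suc n) = residue u n * f n] (mod ?p ^ n)"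
      using f[of n] by (metis cong_sym cong_trans)
    hence "[f (Suc n) = f n] (mod ?p ^ n)"
      using cop[of n] by (simp add: cong_mult_lcancel)
    thus ?thesis unfolding cong_def f_def by simp
  qed
  hence res: "residue (Abs_padic_int f :: 'p padic_int) = f"
    by (intro Abs_padic_int_inverse) blast
  have "1 = u * Abs_padic_int f"
    using f by (intro padic_int_eqI) (simp add: res one_padic_int.rep_eq times_padic_int.rep_eq cong_def)
  thus ?thesis by (rule dvdI)
qed

lemma padic_int_dvd_p_power:
  assumes "b \<noteq> (0 :: 'p::prime_card padic_int)"
  obtains v where "b dvd of_nat CARD('p) ^ v"
proof -
  let ?P = "of_nat CARD('p) :: 'p padic_int"
  have "\<exists>n. residue b n \<noteq> 0" using assms by (metis padic_int_eqI zero_padic_int.rep_eq)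
  define w where "w = (LEAST n. residue b n \<noteq> 0)"
  have w: "residue b w \<noteq> 0" unfolding w_def by (rule LeastI_ex) fact
  have "residue b 0 = 0" using residue_mod[of b 0] by simp
  with w obtain v where v: "w = Suc v" by (cases w) auto
  have "residue b v = 0" using not_less_Least[of v "\<lambda>n. residue b n \<noteq> 0"] v w_def by auto
  then obtain u where u: "b = ?P ^ v * u" using padic_int_residue_decomp[of b v] by auto
  have "residue u 1 \<noteq> 0"
  proof
    assume "residue u 1 = 0"
    then obtain t where "u = ?P * t" using padic_int_residue_decomp[of u 1] by auto
    hence "b = ?P ^ w * t" using u v by (simp add: mult_ac)
    thus False using w residue_of_nat_power_mult by metis
  qed
  hence "?P ^ v * u dvd ?P ^ v * 1" by (intro mult_dvd_mono padic_int_unit) simp_all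
  thus thesis using that u by (metis mult.right_neutral)
qed

lemma padic_decomp:
  obtains m x where "(\<beta> :: 'p::prime_card padic) = padic_p powi (- int m) * to_fract x"
proof -
  obtain a b :: "'p padic_int" where ab: "b \<noteq> 0" "\<beta> = Fraction_Field.Fract a b"
    by (cases \<beta>) auto
  obtain v t where v: "of_nat CARD('p) ^ v = b * t"
    using padic_int_dvd_p_power[OF ab(1)] by (metis dvdE)
  have "padic_p ^ v = to_fract b * to_fract t"
    by (metis v to_fract_mult to_fract_power to_fract_of_nat)
  moreover have "\<beta> * to_fract b = to_fract a"
    using ab by (simp add: to_fract_def eq_fract)
  ultimately have "\<beta> * padic_p ^ v = to_fract (a * t)"
    by (metis mult.assoc to_fract_mult)
  hence "\<beta> = padic_p powi (- int v) * to_fract (a * t)"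
    by (simp add: power_int_minus field_simps)
  thus thesis by (rule that)
qed

lemma padic_series_exists: "\<exists>c. padic_series c (\<beta> :: 'p::prime_card padic)"
proof -
  let ?p = "int CARD('p)" and ?P = "padic_p :: 'p padic"
  obtain m x where \<beta>: "\<beta> = ?P powi (- int m) * to_fract x" by (rule padic_decomp)
  define e where "e = (\<lambda>n. nat (residue x (Suc n) div ?p ^ n))"
  have nonneg: "residue x (Suc n) div ?p ^ n \<ge> 0" for n
  proof -
    have "residue x (Suc n) \<ge> 0" using residue_mod[of x "Suc n"] by (metis pos_mod_sign of_nat_0_less_iff zero_less_card_finite zero_less_power)
    thus ?thesis by (simp add: pos_imp_zdiv_nonneg_iff)
  qed
  have e_int: "int (e n) = residue x (Suc n) div ?p ^ n" for n
    using nonneg[of n] by (simp add: e_def)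
  have e_less: "e n < CARD('p)" for n
  proof -
    have "residue x (Suc n) < ?p ^ Suc n"
      using residue_mod[of x "Suc n"] by (metis pos_mod_bound of_nat_0_less_iff zero_less_card_finite zero_less_power)
    moreover have "residue x (Suc n) div ?p ^ n * ?p ^ n \<le> residue x (Suc n)"
      by (metis div_mult_mod_eq le_add_same_cancel1 pos_mod_sign of_nat_0_less_iff zero_less_card_finite zero_less_power)
    ultimately have "int (e n) * ?p ^ n < ?p * ?p ^ n"
      unfolding e_int power_Suc by linarith
    hence "int (e n) < ?p" by (rule mult_right_less_imp_less) simp
    thus ?thesis by simp
  qed
  have e_sum: "(\<Sum>i<n. int (e i) * ?p ^ i) = residue x n" for n
  proof (induction n)
    case 0
    show ?case using residue_mod[of x 0] by simp
  next
    case (Suc n)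
    have "residue x (Suc n) = residue x (Suc n) div ?p ^ n * ?p ^ n + residue x n"
      using residue_Suc_mod[of x n] by (metis div_mult_mod_eq)
    thus ?case using Suc.IH by (simp add: e_int)
  qed
  define c where "c = (\<lambda>n::int. if n \<ge> - int m then e (nat (n + int m)) else 0)"
  have "\<beta> - (\<Sum>n=-M..M. of_nat (c n) * ?P powi n) \<in> (*) (?P ^ k) ` padic_ints"
    if M: "M \<ge> max (int m) (int k)" for k M
  proof -
    define L where "L = nat (M + int m + 1)"
    have "(\<Sum>n=-M..M. of_nat (c n) * ?P powi n) = (\<Sum>n=- int m..M. of_nat (c n) * ?P powi n)"
      by (rule sum.mono_neutral_right) (use M in \<open>auto simp: c_def\<close>)
    also have "\<dots> = (\<Sum>i<L. of_nat (e i) * ?P powi (int i - int m))"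
      by (rule sum.reindex_bij_witness[of _ "\<lambda>i. int i - int m" "\<lambda>n. nat (n + int m)"])
        (use M in \<open>auto simp: c_def L_def\<close>)
    also have "\<dots> = ?P powi (- int m) * (\<Sum>i<L. of_nat (e i) * ?P ^ i)"
      by (simp add: sum_distrib_left power_int_diff power_int_minus field_simps)
    also have "(\<Sum>i<L. of_nat (e i) * ?P ^ i) = of_int (\<Sum>i<L. int (e i) * ?p ^ i)"
      by simp
    also have "\<dots> = of_int (residue x L)" by (simp only: e_sum)
    finally have S: "(\<Sum>n=-M..M. of_nat (c n) * ?P powi n) = ?P powi (- int m) * of_int (residue x L)" .
    obtain y where "x = of_int (residue x L) + of_nat CARD('p) ^ L * y"
      using padic_int_residue_decomp by blast
    hence "to_fract x = of_int (residue x L) + ?P ^ L * to_fract y"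
      by (metis to_fract_add to_fract_mult to_fract_of_int to_fract_of_nat to_fract_power)
    hence "\<beta> - (\<Sum>n=-M..M. of_nat (c n) * ?P powi n) = ?P powi (- int m) * ?P ^ L * to_fract y"
      unfolding S \<beta> by (simp add: algebra_simps)
    also have "?P powi (- int m) * ?P ^ L = ?P ^ k * ?P ^ nat (M + 1 - int k)"
    proof -
      have "?P powi (- int m) * ?P ^ L = ?P powi (- int m + int L)"
        by (rule padic_p_powi_mult_power)
      also have "- int m + int L = int (k + nat (M + 1 - int k))"
        using M by (simp add: L_def)
      finally show ?thesis by (simp only: power_int_of_nat power_add)
    qed
    finally have "\<beta> - (\<Sum>n=-M..M. of_nat (c n) * ?P powi n) =
        ?P ^ k * (?P ^ nat (M + 1 - int k) * to_fract y)" by (simp add: mult.assoc)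
    moreover have "?P ^ nat (M + 1 - int k) * to_fract y \<in> padic_ints"
      by (intro padic_ints_mult padic_ints_power padic_ints_of_nat) (simp add: padic_ints_def)
    ultimately show ?thesis by blast
  qed
  hence "\<forall>k. \<exists>M. \<forall>m\<ge>M. \<beta> - (\<Sum>n=-m..m. of_nat (c n) * ?P powi n) \<in> (*) (?P ^ k) ` padic_ints"
    by blast
  moreover have "\<forall>n<(- int m). c n = 0" by (simp add: c_def)
  moreover have "\<forall>n. c n < CARD('p)" using e_less by (simp add: c_def)
  ultimately have "padic_series c \<beta>"
    unfolding padic_series_def by blast
  thus ?thesis by blast
qed

lemma padic_series_digits_unique:
  assumes c: "padic_series c (\<beta> :: 'p::prime_card padic)" and d: "padic_series d \<beta>"
  shows "c = d"
proof (rule ccontr)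
  let ?p = "int CARD('p)" and ?P = "padic_p :: 'p padic"
  assume "c \<noteq> d"
  then obtain i where i: "c i \<noteq> d i" by auto
  obtain N where N: "\<And>n. n < N \<Longrightarrow> c n = d n"
  proof -
    obtain N1 N2 where "\<forall>n<N1. c n = 0" "\<forall>n<N2. d n = 0"
      using c d unfolding padic_series_def by blast
    thus thesis by (intro that[of "min N1 N2"]) simp
  qed
  define l where "l = (LEAST l. c (N + int l) \<noteq> d (N + int l))"
  define s where "s = N + int l"
  have "i \<ge> N" using N i by force
  hence ex: "\<exists>l. c (N + int l) \<noteq> d (N + int l)"
    using i by (intro exI[of _ "nat (i - N)"]) simp
  have s: "c s \<noteq> d s" unfolding s_def l_def using LeastI_ex[OF ex] .
  have below: "c n = d n" if "n < s" for n
  proof (cases "n < N")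
    case False
    hence "nat (n - N) < l" using that by (simp add: s_def)
    from not_less_Least[OF this[unfolded l_def]] False show ?thesis by simp
  qed (rule N)
  define k where "k = nat (s + 1)"
  obtain M1 M2 where
    M1: "\<forall>m\<ge>M1. \<beta> - (\<Sum>n=-m..m. of_nat (c n) * ?P powi n) \<in> (*) (?P ^ k) ` padic_ints" and
    M2: "\<forall>m\<ge>M2. \<beta> - (\<Sum>n=-m..m. of_nat (d n) * ?P powi n) \<in> (*) (?P ^ k) ` padic_ints"
    using c d unfolding padic_series_def by blast
  define m where "m = Max {M1, M2, \<bar>s\<bar>}"
  have m: "m \<ge> M1" "m \<ge> M2" "m \<ge> s" "- m \<le> s" by (auto simp: m_def)
  define S where "S = (\<Sum>n=s..m. (int (c n) - int (d n)) * ?p ^ nat (n - s))"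
  have "(\<Sum>n=-m..m. of_nat (c n) * ?P powi n) - (\<Sum>n=-m..m. of_nat (d n) * ?P powi n)
      = (\<Sum>n=-m..m. (of_nat (c n) - of_nat (d n)) * ?P powi n)"
    by (simp add: sum_subtractf left_diff_distrib)
  also have "\<dots> = (\<Sum>n=s..m. (of_nat (c n) - of_nat (d n)) * ?P powi n)"
    by (rule sum.mono_neutral_right) (use m below in auto)
  also have "\<dots> = (\<Sum>n=s..m. ?P powi s * ((of_nat (c n) - of_nat (d n)) * ?P ^ nat (n - s)))"
  proof (rule sum.cong)
    fix n assume "n \<in> {s..m}"
    hence "n = s + int (nat (n - s))" by simp
    hence "?P powi n = ?P powi s * ?P ^ nat (n - s)"
      by (metis power_int_add power_int_of_nat padic_p_nonzero)
    thus "(of_nat (c n) - of_nat (d n)) * ?P powi n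
        = ?P powi s * ((of_nat (c n) - of_nat (d n)) * ?P ^ nat (n - s))" by simp
  qed simp
  also have "\<dots> = ?P powi s * of_int S"
    by (simp add: S_def sum_distrib_left)
  finally have diff: "(\<beta> - (\<Sum>n=-m..m. of_nat (d n) * ?P powi n)) -
      (\<beta> - (\<Sum>n=-m..m. of_nat (c n) * ?P powi n)) = ?P powi s * of_int S" by simp
  have "?P powi s * of_int S \<in> (*) (?P ^ k) ` padic_ints"
    unfolding diff[symmetric] using M1 M2 m by - (rule padic_p_multiple_diff, auto)
  then obtain w where w: "?P powi s * of_int S = ?P ^ k * w" "w \<in> padic_ints" by auto
  have "of_int S = ?P powi (- s) * (?P powi s * of_int S)"
    by (simp add: power_int_minus)
  also have "\<dots> = ?P powi (- s) * ?P ^ k * w" unfolding w(1) by simp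
  also have "?P powi (- s) * ?P ^ k = ?P powi (- s + int k)"
    by (rule padic_p_powi_mult_power)
  also have "- s + int k = int (Suc (nat (int k - s - 1)))" by (simp add: k_def)
  finally have "of_int S = ?P ^ 1 * (?P ^ nat (int k - s - 1) * w)"
    by (simp only: power_int_of_nat power_Suc power_one_right mult.assoc)
  moreover have "?P ^ nat (int k - s - 1) * w \<in> padic_ints"
    using w(2) by (intro padic_ints_mult padic_ints_power) simp_all
  ultimately have "?p ^ 1 dvd S" by (intro of_int_padic_p_multipleD) blast
  moreover have "S = (int (c s) - int (d s)) + (\<Sum>n\<in>{s<..m}. (int (c n) - int (d n)) * ?p ^ nat (n - s))"
  proof -
    have "{s..m} = insert s {s<..m}" using m(3) by auto
    thus ?thesis by (simp add: S_def)
  qed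
  moreover have "?p dvd (\<Sum>n\<in>{s<..m}. (int (c n) - int (d n)) * ?p ^ nat (n - s))"
    by (intro dvd_sum dvd_mult) (auto intro!: dvd_power)
  ultimately have "?p dvd int (c s) - int (d s)" by (simp add: dvd_add_left_iff)
  moreover have "\<bar>int (c s) - int (d s)\<bar> < ?p"
  proof -
    have "c s < CARD('p)" "d s < CARD('p)" using c d by (auto simp: padic_series_def)
    thus ?thesis by linarith
  qed
  ultimately show False using s dvd_imp_le_int[of "int (c s) - int (d s)" ?p] by auto
qed

lemma padic_series_limit_unique:
  assumes b: "padic_series c (\<beta> :: 'p::prime_card padic)" and g: "padic_series c \<gamma>"
  shows "\<beta> = \<gamma>"
proof -
  let ?P = "padic_p :: 'p padic"
  have mult: "\<beta> - \<gamma> \<in> (*) (?P ^ k) ` padic_ints" for k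
  proof -
    obtain M1 M2 where
      "\<forall>m\<ge>M1. \<beta> - (\<Sum>n=-m..m. of_nat (c n) * ?P powi n) \<in> (*) (?P ^ k) ` padic_ints"
      "\<forall>m\<ge>M2. \<gamma> - (\<Sum>n=-m..m. of_nat (c n) * ?P powi n) \<in> (*) (?P ^ k) ` padic_ints"
      using b g unfolding padic_series_def by blast
    hence "(\<beta> - (\<Sum>n=-max M1 M2..max M1 M2. of_nat (c n) * ?P powi n)) -
        (\<gamma> - (\<Sum>n=-max M1 M2..max M1 M2. of_nat (c n) * ?P powi n)) \<in> (*) (?P ^ k) ` padic_ints"
      by - (rule padic_p_multiple_diff, auto)
    thus ?thesis by simp
  qed
  obtain x :: "'p padic_int" where x: "\<beta> - \<gamma> = to_fract x"
    using mult[of 0] by (auto simp: padic_ints_def)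
  have "residue x k = residue 0 k" for k
  proof -
    obtain y :: "'p padic_int" where "to_fract x = ?P ^ k * to_fract y"
      using mult[of k] x by (auto simp: padic_ints_def)
    hence "x = of_nat CARD('p) ^ k * y"
      by (metis to_fract_eq_iff to_fract_mult to_fract_of_nat to_fract_power)
    thus ?thesis by (simp add: residue_of_nat_power_mult zero_padic_int.rep_eq)
  qed
  hence "x = 0" by (rule padic_int_eqI)
  thus ?thesis using x by simp
qed

definition padic_digits :: "'p::prime_card padic \<Rightarrow> int \<Rightarrow> nat" where
  "padic_digits \<beta> = (THE c. padic_series c \<beta>)"

definition padic_ord :: "'p::prime_card padic \<Rightarrow> int extended" where
  "padic_ord \<beta> = (if \<beta> = 0 then Pinf else Fin (LEAST n. padic_digits \<beta> n \<noteq> 0))"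

definition padic_omega :: "'p::prime_card padic \<Rightarrow> nat" where
  "padic_omega \<beta> = padic_digits \<beta> 0"

definition padic_bracket :: "'p::prime_card padic \<Rightarrow> 'p padic" where
  "padic_bracket \<beta> = (THE \<gamma>. padic_series (\<lambda>n. if n \<ge> 1 then padic_digits \<beta> n else 0) \<gamma>)"

lemma padic_series_digits: "padic_series (padic_digits \<beta>) \<beta>"
  unfolding padic_digits_def
  using padic_series_exists padic_series_digits_unique by (metis (mono_tags) theI')

lemma padic_series_bracket:
  "padic_series (\<lambda>n. if n \<ge> 1 then padic_digits \<beta> n else 0) (padic_bracket \<beta>)"
proof -
  let ?P = "padic_p :: 'a padic" and ?c = "padic_digits \<beta>"
  let ?d = "\<lambda>n. if n \<ge> 1 then ?c n else 0"
  obtain N where N: "\<forall>n<N. ?c n = 0"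
    using padic_series_digits[of \<beta>] unfolding padic_series_def by blast
  define \<gamma> where "\<gamma> = \<beta> - (\<Sum>n=N..0. of_nat (?c n) * ?P powi n)"
  have "padic_series ?d \<gamma>"
    unfolding padic_series_def
  proof (intro conjI allI)
    show "?d n < CARD('a)" for n
      using padic_series_digits[of \<beta>] by (auto simp: padic_series_def)
    show "\<exists>N. \<forall>n<N. ?d n = 0" by (intro exI[of _ 0]) simp
    fix k
    obtain M where M: "\<forall>m\<ge>M. \<beta> - (\<Sum>n=-m..m. of_nat (?c n) * ?P powi n) \<in> (*) (?P ^ k) ` padic_ints"
      using padic_series_digits[of \<beta>] unfolding padic_series_def by blast
    have "\<gamma> - (\<Sum>n=-m..m. of_nat (?d n) * ?P powi n) \<in> (*) (?P ^ k) ` padic_ints"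
      if m: "m \<ge> max M \<bar>N\<bar>" for m
    proof -
      have "(\<Sum>n=-m..m. of_nat (?c n) * ?P powi n) =
          (\<Sum>n\<in>{-m..0}. of_nat (?c n) * ?P powi n) + (\<Sum>n\<in>{1..m}. of_nat (?c n) * ?P powi n)"
        using m by (subst sum.union_disjoint[symmetric]) (auto intro!: sum.cong)
      moreover have "(\<Sum>n\<in>{-m..0}. of_nat (?c n) * ?P powi n) = (\<Sum>n=N..0. of_nat (?c n) * ?P powi n)"
        by (rule sum.mono_neutral_right) (use m N in auto)
      moreover have "(\<Sum>n=-m..m. of_nat (?d n) * ?P powi n) = (\<Sum>n\<in>{1..m}. of_nat (?c n) * ?P powi n)"
        using m by (intro sum.mono_neutral_cong_right) auto
      ultimately have "\<gamma> - (\<Sum>n=-m..m. of_nat (?d n) * ?P powi n) =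
          \<beta> - (\<Sum>n=-m..m. of_nat (?c n) * ?P powi n)"
        by (simp add: \<gamma>_def)
      thus ?thesis using M m by simp
    qed
    thus "\<exists>M. \<forall>m\<ge>M. \<gamma> - (\<Sum>n=-m..m. of_nat (?d n) * ?P powi n) \<in> (*) (?P ^ k) ` padic_ints"
      by blast
  qed
  thus ?thesis
    unfolding padic_bracket_def using padic_series_limit_unique by (metis (mono_tags, lifting) theI')
qed

text \<open>\<open>p\<close> to the power of an order; the value at infinity is immaterial.\<close>

fun padic_p_pow :: "int extended \<Rightarrow> 'p::prime_card padic" where
  "padic_p_pow (Fin n) = padic_p powi n"
| "padic_p_pow Pinf = 0"
| "padic_p_pow Minf = 0"


section \<open>Subfields, minimal polynomials and condition (H)\<close>

definition subfield_set :: "'a::field set \<Rightarrow> bool" where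
  "subfield_set F \<longleftrightarrow> 0 \<in> F \<and> 1 \<in> F \<and> (\<forall>x\<in>F. \<forall>y\<in>F. x - y \<in> F \<and> x * y \<in> F) \<and> (\<forall>x\<in>F. inverse x \<in> F)"

text \<open>The smallest subfield containing \<open>z\<close>; in characteristic zero it contains the rationals.\<close>

definition rat_adjoin :: "'a::field_char_0 \<Rightarrow> 'a set" where
  "rat_adjoin z = \<Inter>{F. subfield_set F \<and> z \<in> F}"

definition rat_scale :: "rat \<Rightarrow> 'a::field_char_0 \<Rightarrow> 'a" where
  "rat_scale q x = of_rat q * x"

interpretation rat_vs: vector_space "rat_scale :: rat \<Rightarrow> 'a::field_char_0 \<Rightarrow> 'a"
  by unfold_locales (simp_all add: rat_scale_def of_rat_add of_rat_mult algebra_simps)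

definition is_min_poly :: "rat poly \<Rightarrow> 'a::field_char_0 \<Rightarrow> bool" where
  "is_min_poly f x \<longleftrightarrow> lead_coeff f = 1 \<and> poly (map_poly of_rat f) x = 0 \<and>
     (\<forall>g. g \<noteq> 0 \<and> poly (map_poly of_rat g) x = 0 \<longrightarrow> degree f \<le> degree g)"

lemma is_min_poly_unique:
  fixes x :: "'a::field_char_0"
  assumes f: "is_min_poly f x" and g: "is_min_poly g x"
  shows "f = g"
proof (rule ccontr)
  assume "f \<noteq> g"
  have nz: "f \<noteq> 0" "g \<noteq> 0" using f g by (auto simp: is_min_poly_def)
  have deg: "degree f = degree g"
    using f g nz by (intro antisym) (simp_all add: is_min_poly_def)
  have "map_poly of_rat (f - g) = map_poly of_rat f - (map_poly of_rat g :: 'a poly)"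
    by (rule poly_eqI) (simp add: coeff_map_poly of_rat_diff)
  hence "poly (map_poly of_rat (f - g)) x = 0"
    using f g by (simp add: is_min_poly_def)
  hence le: "degree f \<le> degree (f - g)"
    using f \<open>f \<noteq> g\<close> by (simp add: is_min_poly_def)
  have "degree (f - g) \<le> degree f" using deg by (simp add: degree_diff_le)
  with le have "degree (f - g) = degree f" by simp
  hence "lead_coeff (f - g) = 0"
    using f g deg by (simp add: is_min_poly_def)
  thus False using \<open>f \<noteq> g\<close> by (simp only: leading_coeff_0_iff right_minus_eq)
qed

text \<open>In the minimal polynomial \<open>x^n + b\<^sub>1 x^(n-1) + \<dots> + b\<^sub>n\<close>, the coefficient of index \<open>1\<close>
  (resp. \<open>0\<close>) is \<open>b\<^sub>n\<^sub>-\<^sub>1\<close> (resp. \<open>b\<^sub>n\<close>).\<close>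

definition condition_H :: "'p::prime_card padic \<Rightarrow> bool" where
  "condition_H \<beta> \<longleftrightarrow> algebraic \<beta> \<and> \<beta> \<notin> \<rat> \<and> \<beta> \<in> (*) padic_p ` padic_ints \<and>
     (\<exists>f. is_min_poly f \<beta> \<and>
       (\<forall>i. (of_rat (Polynomial.coeff f i) :: 'p padic) \<in> padic_ints) \<and>
       padic_ord (of_rat (Polynomial.coeff f 1) :: 'p padic) = 0 \<and>
       padic_ord (of_rat (Polynomial.coeff f 0) :: 'p padic) > 0)"

section \<open>The algorithm\<close>

text \<open>A vector \<open>(\<alpha>\<^sub>1, \<dots>, \<alpha>\<^sub>s)\<close> is a list of length \<open>s\<close>; list positions start at \<open>0\<close>, so
  \<open>\<alpha> ! 0\<close> is \<open>\<alpha>\<^sub>1\<close>. If \<open>\<alpha> ! i = 0\<close>, then \<^const>\<open>padic_ord\<close> is \<^const>\<open>Pinf\<close> and the exponent of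
  \<open>p\<close> below is \<open>max Minf 0 = 0\<close>.\<close>

definition phi_g :: "int \<Rightarrow> 'p::prime_card padic list \<Rightarrow> nat \<Rightarrow> 'p padic" where
  "phi_g \<epsilon> \<alpha> i =
    (if \<alpha> ! 0 = 0 then \<alpha> ! i
     else let y = (if i = 0 then of_int \<epsilon> * padic_p_pow (padic_ord (\<alpha> ! 0)) / (\<alpha> ! 0)
                   else of_int \<epsilon> * padic_p_pow (max (padic_ord (\<alpha> ! 0) - padic_ord (\<alpha> ! i)) 0)
                          * (\<alpha> ! i) / (\<alpha> ! 0))
          in y - of_nat (padic_omega y))"

definition z_coords :: "nat \<Rightarrow> 'a::field_char_0 \<Rightarrow> 'a \<Rightarrow> nat \<Rightarrow> rat" where
  "z_coords s z g = (THE a. g = (\<Sum>j\<le>s. of_rat (a j) * z ^ j) \<and> (\<forall>j>s. a j = 0))"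

definition coprime_content :: "nat \<Rightarrow> nat \<Rightarrow> (nat \<Rightarrow> rat) \<Rightarrow> nat" where
  "coprime_content p s a =
    (if \<forall>j\<in>{1..s}. a j = 0 then 1
     else Max {d. d > 0 \<and> coprime d p \<and> (\<forall>j\<in>{1..s}. int d dvd fst (quotient_of (a j)))})"

definition phi_h :: "int \<Rightarrow> 'p::prime_card padic \<Rightarrow> 'p padic list \<Rightarrow> nat \<Rightarrow> 'p padic" where
  "phi_h \<epsilon> z \<alpha> i =
    (let g = phi_g \<epsilon> \<alpha> i;
         a = z_coords (length \<alpha>) z g;
         d = coprime_content CARD('p) (length \<alpha>) a
     in g / of_nat d - padic_bracket (of_rat (a 0 / of_nat d)))"

definition phi_map :: "int \<Rightarrow> 'p::prime_card padic \<Rightarrow> 'p padic list \<Rightarrow> 'p padic list" where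
  "phi_map \<epsilon> z \<alpha> = rotate1 (map (phi_h \<epsilon> z \<alpha>) [0..<length \<alpha>])"

end

theory Submission
  imports Defs
begin

text \<open>Let \<open>q = z\<^sup>2 + a\<^sub>1 z + a\<^sub>2\<close>. Since \<open>a\<^sub>2\<close> is a unit of the p-adic integers, so is \<open>q\<close>, and
  \<open>z q = - a\<^sub>3 p^k\<close> shows that \<open>z\<close> has order \<open>k\<close> with \<open>p^k / z = - q / a\<^sub>3\<close>. Hence, starting from
  \<open>(z / d, (z\<^sup>2 + b z) / e)\<close> with an integer \<open>b\<close> and \<open>d, e dvd a\<^sub>3\<close>, the two quotients formed by the algorithm
  are \<open>- \<epsilon> d q / a\<^sub>3\<close> and \<open>\<epsilon> d (z + b) / e\<close>. Subtracting the leading digit and the bracket removes exactly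
  their rational coordinate, and dividing by \<open>a'\<^sub>i\<close> cancels the numerators of \<open>d / a\<^sub>3\<close> and \<open>d / e\<close>.
  What remains is \<open>(z / d', (z\<^sup>2 + a\<^sub>1 z) / e')\<close> with \<open>d'\<close> and \<open>e'\<close> again divisors of \<open>a\<^sub>3\<close>: a finite set of
  states, which the orbit enters after one step (\<open>b = 0\<close>, \<open>d = e = 1\<close>) and never leaves.\<close>


section \<open>Residues and digits of p-adic integers\<close>

lemma padic_ints_add: "x \<in> padic_ints \<Longrightarrow> y \<in> padic_ints \<Longrightarrow> x + y \<in> padic_ints"
  unfolding padic_ints_def by (auto simp flip: to_fract_add)

lemma padic_ints_minus: "x \<in> padic_ints \<Longrightarrow> - x \<in> padic_ints"
  using padic_ints_diff[of 0 x] padic_ints_of_nat[of 0] by simp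

lemma padic_ints_to_fract [simp]: "to_fract x \<in> padic_ints"
  by (simp add: padic_ints_def)

lemmas padic_ints_intros = padic_ints_add padic_ints_minus padic_ints_diff padic_ints_mult
  padic_ints_power padic_ints_of_int padic_ints_of_nat

lemma residue_nonneg: "residue (x :: 'p::prime_card padic_int) n \<ge> 0"
  using residue_mod[of x n]
  by (metis pos_mod_sign of_nat_0_less_iff zero_less_card_finite zero_less_power)

lemma residue_less: "residue (x :: 'p::prime_card padic_int) n < int CARD('p) ^ n"
  using residue_mod[of x n]
  by (metis pos_mod_bound of_nat_0_less_iff zero_less_card_finite zero_less_power)

lemma residue_0 [simp]: "residue (x :: 'p::prime_card padic_int) 0 = 0"
  using residue_mod[of x 0] by simp

lemma residue_eq_0_iff_dvd:
  "residue (x :: 'p::prime_card padic_int) n = 0 \<longleftrightarrow> of_nat CARD('p) ^ n dvd x"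
proof
  assume "residue x n = 0"
  with padic_int_residue_decomp[of x n] show "of_nat CARD('p) ^ n dvd x" by auto
next
  assume "of_nat CARD('p) ^ n dvd x"
  thus "residue x n = 0" by (auto elim!: dvdE simp: residue_of_nat_power_mult)
qed

lemma residue_digit_sum:
  fixes x :: "'p::prime_card padic_int"
  shows "(\<Sum>i<n. residue x (Suc i) div int CARD('p) ^ i * int CARD('p) ^ i) = residue x n"
proof (induction n)
  case (Suc n)
  have "residue x (Suc n) = residue x (Suc n) div int CARD('p) ^ n * int CARD('p) ^ n + residue x n"
    using residue_Suc_mod[of x n] by (metis div_mult_mod_eq)
  thus ?case using Suc.IH by simp
qed simp

text \<open>The digit of index \<open>n\<close> is the increment from the residue modulo
  \<open>p ^ n\<close> to the residue modulo \<open>p ^ (n + 1)\<close>, divided by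
  \<open>p ^ n\<close>; the partial sums therefore telescope to residues. Together with uniqueness
  of expansions this makes leading digits, brackets and orders computable from residues.\<close>

lemma padic_series_to_fract:
  fixes x :: "'p::prime_card padic_int"
  shows "padic_series (\<lambda>n. if n \<ge> 0 then nat (residue x (Suc (nat n)) div int CARD('p) ^ nat n) else 0)
           (to_fract x)"
    (is "padic_series ?c _")
  unfolding padic_series_def
proof (intro conjI allI)
  let ?p = "int CARD('p)" and ?P = "padic_p :: 'p padic"
  have p: "?p > 0" by simp
  show "?c n < CARD('p)" for n
  proof -
    have "residue x (Suc m) div ?p ^ m < ?p" for m
    proof -
      have "residue x (Suc m) div ?p ^ m * ?p ^ m \<le> residue x (Suc m)"
        using pos_mod_sign[of "?p ^ m" "residue x (Suc m)"] p
        by (simp add: minus_mod_eq_div_mult[symmetric])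
      also have "\<dots> < ?p * ?p ^ m" using residue_less[of x "Suc m"] by simp
      finally show ?thesis by (rule mult_right_less_imp_less) simp
    qed
    thus ?thesis using p by (simp add: nat_less_iff residue_nonneg pos_imp_zdiv_nonneg_iff)
  qed
  show "\<exists>N. \<forall>n<N. ?c n = 0" by (intro exI[of _ 0]) simp
  fix k :: nat
  have "to_fract x - (\<Sum>n=-M..M. of_nat (?c n) * ?P powi n) \<in> (*) (?P ^ k) ` padic_ints"
    if M: "M \<ge> int k" for M
  proof -
    \<comment> \<open>The indices from 0 to \<open>M\<close> give \<open>M + 1\<close> digits, so
      this partial sum is the residue modulo \<open>p ^ (M + 1)\<close>.\<close>
    define L where "L = nat (M + 1)"
    have "(\<Sum>n=-M..M. of_nat (?c n) * ?P powi n) = (\<Sum>n=0..M. of_nat (?c n) * ?P powi n)"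
      by (rule sum.mono_neutral_right) (use M in auto)
    also have "\<dots> = (\<Sum>i<L. of_nat (?c (int i)) * ?P powi (int i))"
      by (rule sum.reindex_bij_witness[of _ "\<lambda>i. int i" nat]) (use M in \<open>auto simp: L_def\<close>)
    also have "\<dots> = of_int (\<Sum>i<L. residue x (Suc i) div ?p ^ i * ?p ^ i)"
      unfolding of_int_sum
    proof (intro sum.cong refl)
      fix i
      have "(of_nat (?c (int i)) :: 'p padic) = of_int (residue x (Suc i) div ?p ^ i)"
        by (simp add: residue_nonneg pos_imp_zdiv_nonneg_iff)
      thus "of_nat (?c (int i)) * ?P powi (int i) = of_int (residue x (Suc i) div ?p ^ i * ?p ^ i)"
        by simp
    qed
    also have "\<dots> = of_int (residue x L)" by (simp only: residue_digit_sum)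
    finally have S: "(\<Sum>n=-M..M. of_nat (?c n) * ?P powi n) = of_int (residue x L)" .
    obtain y where "x = of_int (residue x L) + of_nat CARD('p) ^ L * y"
      using padic_int_residue_decomp by blast
    hence "to_fract x = of_int (residue x L) + ?P ^ L * to_fract y"
      by (metis to_fract_add to_fract_mult to_fract_of_int to_fract_of_nat to_fract_power)
    moreover have "L = k + (L - k)" using M by (simp add: L_def)
    hence "?P ^ L = ?P ^ k * ?P ^ (L - k)" by (metis power_add)
    ultimately have "to_fract x - of_int (residue x L) = ?P ^ k * (?P ^ (L - k) * to_fract y)"
      by (simp add: mult.assoc)
    moreover have "?P ^ (L - k) * to_fract y \<in> padic_ints"
      by (intro padic_ints_intros padic_ints_to_fract)
    ultimately show ?thesis unfolding S by blast
  qed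
  thus "\<exists>M. \<forall>m\<ge>M. to_fract x - (\<Sum>n=-m..m. of_nat (?c n) * ?P powi n) \<in> (*) (?P ^ k) ` padic_ints"
    by blast
qed

lemma padic_digits_to_fract:
  fixes x :: "'p::prime_card padic_int"
  shows "padic_digits (to_fract x) n =
    (if n \<ge> 0 then nat (residue x (Suc (nat n)) div int CARD('p) ^ nat n) else 0)"
  using padic_series_digits_unique[OF padic_series_digits padic_series_to_fract, of x]
  by (rule fun_cong)

section \<open>Leading digit, bracket and order\<close>

text \<open>The digit of index 0 of a p-adic integer is its residue modulo \<open>p\<close>.\<close>

lemma diff_padic_omega:
  assumes "x \<in> padic_ints"
  shows "x - of_nat (padic_omega x) \<in> (*) padic_p ` (padic_ints :: 'p::prime_card padic set)"
proof -
  obtain y where x: "x = to_fract y" using assms by (auto simp: padic_ints_def)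
  obtain t where "y = of_int (residue y 1) + of_nat CARD('p) ^ 1 * t"
    using padic_int_residue_decomp by blast
  hence "to_fract y = of_int (residue y 1) + padic_p * to_fract t"
    by (metis power_one_right to_fract_add to_fract_mult to_fract_of_int to_fract_of_nat)
  moreover have "(of_nat (padic_omega x) :: 'p padic) = of_int (residue y 1)"
    by (simp add: padic_omega_def x padic_digits_to_fract residue_nonneg)
  ultimately show ?thesis by (simp add: x)
qed

text \<open>The bracket only drops digits of index at most 0, and a multiple of \<open>p\<close> has
  none. Through this fact the bracket later removes a whole rational coordinate.\<close>

lemma padic_bracket_ident:
  assumes "x \<in> (*) padic_p ` (padic_ints :: 'p::prime_card padic set)"
  shows "padic_bracket x = x"
proof -
  obtain y where "x = padic_p * to_fract y" using assms by (auto simp: padic_ints_def)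
  hence x: "x = to_fract (of_nat CARD('p) ^ 1 * y)" by (simp add: to_fract_of_nat)
  have "padic_digits x n = 0" if "n \<le> 0" for n
    using that residue_of_nat_power_mult[of 1 y] unfolding x padic_digits_to_fract by auto
  hence "(\<lambda>n. if n \<ge> 1 then padic_digits x n else 0) = padic_digits x"
    by (intro ext) auto
  with padic_series_bracket[of x] show ?thesis
    using padic_series_limit_unique[OF _ padic_series_digits] by metis
qed

text \<open>The factor \<open>p ^ n\<close> kills all residues up to index \<open>n\<close>, while
  the residue of index \<open>n + 1\<close> survives because \<open>p\<close> does not divide
  \<open>u\<close>; so the first nonzero digit has index \<open>n\<close>.\<close>

lemma padic_ord_power_mult_to_fract:
  fixes u :: "'p::prime_card padic_int"
  assumes u: "residue u 1 \<noteq> 0"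
  shows "padic_ord (padic_p ^ n * to_fract u) = Fin (int n)"
proof -
  let ?p = "of_nat CARD('p) :: 'p padic_int"
  define x where "x = ?p ^ n * u"
  have x: "padic_p ^ n * to_fract u = to_fract x"
    by (simp add: x_def to_fract_of_nat to_fract_power)
  have le: "residue x i = 0" if "i \<le> n" for i
    unfolding residue_eq_0_iff_dvd x_def using that by (simp add: le_imp_power_dvd)
  have "\<not> ?p ^ Suc n dvd x"
    using u by (simp add: x_def residue_eq_0_iff_dvd mult.commute[of ?p])
  hence Suc: "residue x (Suc n) \<noteq> 0" by (simp add: residue_eq_0_iff_dvd)
  have "residue x (Suc n) mod int CARD('p) ^ n = 0"
    using le[of n] by (simp add: residue_Suc_mod)
  hence "residue x (Suc n) div int CARD('p) ^ n \<noteq> 0" using Suc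
    by (metis div_mult_mod_eq add.right_neutral mult_zero_left)
  moreover have "residue x (Suc n) div int CARD('p) ^ n \<ge> 0"
    by (simp add: residue_nonneg pos_imp_zdiv_nonneg_iff)
  ultimately have n: "padic_digits (to_fract x) (int n) \<noteq> 0"
    by (simp add: padic_digits_to_fract)
  have "int n \<le> i" if "padic_digits (to_fract x) i \<noteq> 0" for i
  proof (rule ccontr)
    assume "\<not> int n \<le> i"
    with that le[of "Suc (nat i)"] show False
      by (auto simp: padic_digits_to_fract split: if_splits)
  qed
  with n have "(LEAST i. padic_digits (to_fract x) i \<noteq> 0) = int n"
    by (intro Least_equality) auto
  moreover have "x \<noteq> 0" using Suc by (auto simp: zero_padic_int.rep_eq)
  ultimately show ?thesis by (simp add: x padic_ord_def)
qed

lemma padic_ord_ge: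
  assumes "x \<in> (*) (padic_p ^ n) ` (padic_ints :: 'p::prime_card padic set)" "x \<noteq> 0"
  obtains m where "m \<ge> int n" "padic_ord x = Fin m"
proof -
  let ?p = "of_nat CARD('p) :: 'p padic_int"
  obtain y where y: "x = padic_p ^ n * to_fract y" using assms by (auto simp: padic_ints_def)
  hence "y \<noteq> 0" using assms(2) by auto
  hence "\<exists>i. residue y i \<noteq> 0" by (metis padic_int_eqI zero_padic_int.rep_eq)
  \<comment> \<open>The residue of index 0 always vanishes, so the least \<open>w\<close> is a
    successor \<open>Suc v\<close>, and \<open>p ^ v\<close> is the exact power of \<open>p\<close>
    dividing \<open>y\<close>.\<close>
  then obtain w where w: "residue y w \<noteq> 0" "\<And>i. i < w \<Longrightarrow> residue y i = 0"
    using exists_least_iff[of "\<lambda>i. residue y i \<noteq> 0"] by auto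
  then obtain v where v: "w = Suc v" by (cases w) auto
  have "residue y v = 0" using w(2)[of v] v by simp
  then obtain u where u: "y = ?p ^ v * u" by (auto simp: residue_eq_0_iff_dvd)
  have "residue u 1 \<noteq> 0"
    using w(1) unfolding residue_eq_0_iff_dvd u v by (simp add: mult.commute[of ?p])
  moreover have "x = padic_p ^ (n + v) * to_fract u"
    by (simp add: y u power_add to_fract_of_nat to_fract_power)
  ultimately have "padic_ord x = Fin (int (n + v))"
    by (simp add: padic_ord_power_mult_to_fract del: of_nat_add)
  thus thesis by (intro that[of "int (n + v)"]) auto
qed

text \<open>An inverse inside \<open>padic_ints\<close> forces a nonzero residue modulo
  \<open>p\<close>. Units are described by membership in \<open>padic_ints\<close> so that the
  closure rules can verify them.\<close>

lemma padic_ord_unit_mult: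
  assumes "u \<in> padic_ints" "inverse u \<in> (padic_ints :: 'p::prime_card padic set)" "u \<noteq> 0"
  shows "padic_ord (padic_p ^ n * u) = Fin (int n)"
proof -
  obtain v w where vw: "u = to_fract v" "inverse u = to_fract w"
    using assms by (auto simp: padic_ints_def)
  have "to_fract (v * w) = 1" using vw assms(3) by (metis right_inverse to_fract_mult)
  hence "v * w = 1" by (metis to_fract_1 to_fract_eq_iff)
  have "residue v 1 \<noteq> 0"
  proof
    assume "residue v 1 = 0"
    hence "residue (v * w) 1 = 0" by (simp add: residue_simps)
    thus False using \<open>v * w = 1\<close> CARD_prime_gt_1[where 'p='p] by (simp add: residue_simps)
  qed
  thus ?thesis by (simp add: vw padic_ord_power_mult_to_fract)
qed

text \<open>The residue modulo \<open>p\<close> of the sum is that of \<open>a\<close>, hence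
  nonzero, and such p-adic integers are units. With \<open>x = 0\<close> this inverts integers prime
  to \<open>p\<close>; with \<open>x = z * (z + a1)\<close> it inverts the quadratic cofactor of
  \<open>z\<close>.\<close>

lemma inverse_padic_ints:
  fixes x :: "'p::prime_card padic"
  assumes x: "x \<in> (*) padic_p ` padic_ints" and a: "\<not> int CARD('p) dvd a"
  shows "x + of_int a \<noteq> 0" "inverse (x + of_int a) \<in> padic_ints"
proof -
  obtain y where "x = padic_p * to_fract y" using x by (auto simp: padic_ints_def)
  hence xa: "x + of_int a = to_fract (of_nat CARD('p) ^ 1 * y + of_int a)"
    by (simp add: to_fract_of_nat to_fract_of_int)
  define v where "v = of_nat CARD('p) ^ 1 * y + of_int a"
  have "residue v 1 = a mod int CARD('p)"
    using residue_of_nat_power_mult[of 1 y]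
    unfolding v_def plus_padic_int.rep_eq residue_of_int by simp
  hence v: "residue v 1 \<noteq> 0" using a by (simp add: dvd_eq_mod_eq_0)
  then obtain w where "1 = v * w" using padic_int_unit by blast
  hence vw: "to_fract v * to_fract w = 1" by (metis to_fract_1 to_fract_mult)
  thus "x + of_int a \<noteq> 0" using xa v_def by auto
  have "inverse (to_fract v) = to_fract w" using vw by (rule inverse_unique)
  thus "inverse (x + of_int a) \<in> padic_ints" unfolding xa v_def[symmetric] by simp
qed

lemma padic_ord_of_int_eq_0D:
  assumes "padic_ord (of_int a :: 'p::prime_card padic) = 0"
  shows "\<not> int CARD('p) dvd a"
proof
  assume "int CARD('p) dvd a"
  then obtain b where "a = int CARD('p) * b" by auto
  hence "(of_int a :: 'p padic) \<in> (*) (padic_p ^ 1) ` padic_ints" by simp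
  moreover have "(of_int a :: 'p padic) \<noteq> 0"
    using assms by (auto simp: padic_ord_def zero_extended_def)
  ultimately obtain m where "m \<ge> 1" "padic_ord (of_int a :: 'p padic) = Fin m"
    using padic_ord_ge[of "of_int a :: 'p padic" 1] by auto
  thus False using assms by (simp add: zero_extended_def)
qed


section \<open>Coordinates in powers of z and their content\<close>

text \<open>Two coordinate vectors of the same element differ by the coefficients of a polynomial of
  degree at most \<open>s\<close> that vanishes at \<open>z\<close>, and the minimal polynomial has
  larger degree.\<close>

lemma z_coords_eqI:
  assumes f: "is_min_poly f z" "degree f = Suc s"
    and g: "g = (\<Sum>j\<le>s. of_rat (a j) * z ^ j)" and a: "\<And>j. j > s \<Longrightarrow> a j = 0"
  shows "z_coords s z g = a"
  unfolding z_coords_def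
proof (rule the_equality)
  show "g = (\<Sum>j\<le>s. of_rat (a j) * z ^ j) \<and> (\<forall>j>s. a j = 0)" using g a by blast
  fix b assume b: "g = (\<Sum>j\<le>s. of_rat (b j) * z ^ j) \<and> (\<forall>j>s. b j = 0)"
  define h where "h = (\<Sum>j\<le>s. Polynomial.monom (b j - a j) j)"
  have coeff: "Polynomial.coeff h j = (if j \<le> s then b j - a j else 0)" for j
    by (simp add: h_def coeff_sum)
  have "map_poly of_rat h = (\<Sum>j\<le>s. Polynomial.monom (of_rat (b j - a j)) j :: 'a poly)"
    by (rule poly_eqI) (simp add: coeff_map_poly coeff, simp add: coeff_sum)
  hence "poly (map_poly of_rat h) z = 0"
    using b g by (simp add: poly_sum poly_monom of_rat_diff left_diff_distrib sum_subtractf)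
  moreover have "degree h \<le> s" by (rule degree_le) (simp add: coeff)
  ultimately have "h = 0" using f by (auto simp: is_min_poly_def)
  hence "b j = a j" if "j \<le> s" for j using coeff[of j] that by simp
  thus "b = a" using a b by (intro ext) (metis linorder_not_less)
qed

text \<open>An integer factor can cancel only against the denominator of a reduced fraction, so the
  numerator is never shortened.\<close>

lemma quotient_of_numerator_dvd: "fst (quotient_of r) dvd fst (quotient_of (of_int m * r))"
proof -
  obtain n q n' q' where nq: "quotient_of r = (n, q)" "quotient_of (of_int m * r) = (n', q')"
    by (metis surj_pair)
  have "of_int n' / of_int q' = (of_int m * (of_int n / of_int q) :: rat)"
    using nq by (simp flip: quotient_of_div)
  moreover have "q > 0" "q' > 0" using nq by (auto dest: quotient_of_denom_pos)
  ultimately have "(of_int (n' * q) :: rat) = of_int (m * n * q')"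
    by (simp add: field_simps)
  hence "n' * q = m * n * q'" by (simp only: of_int_eq_iff)
  hence "n dvd n' * q" by simp
  moreover have "coprime n q" using nq(1) by (rule quotient_of_coprime)
  ultimately show ?thesis using nq by (simp add: coprime_dvd_mult_left_iff)
qed

text \<open>If every relevant coordinate is an integer multiple of one of them, \<open>r\<close>,
  then the numerator of \<open>r\<close> divides all numerators and is itself one of them, so up to
  sign it is the largest common divisor.\<close>

lemma coprime_content_eq_numerator:
  assumes j: "j \<in> {1..s}" "a j = r" "r \<noteq> 0"
    and a: "\<And>i. i \<in> {1..s} \<Longrightarrow> \<exists>m. a i = of_int m * r"
    and p: "coprime (nat \<bar>fst (quotient_of r)\<bar>) p"
  shows "coprime_content p s a = nat \<bar>fst (quotient_of r)\<bar>"
proof -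
  let ?n = "fst (quotient_of r)"
  have n: "?n \<noteq> 0"
    using j(3) quotient_of_div[of r "fst (quotient_of r)" "snd (quotient_of r)"] by auto
  have "Max {d. d > 0 \<and> coprime d p \<and> (\<forall>i\<in>{1..s}. int d dvd fst (quotient_of (a i)))} = nat \<bar>?n\<bar>"
    (is "Max ?D = _")
  proof (rule Max_eqI)
    show le: "d \<le> nat \<bar>?n\<bar>" if "d \<in> ?D" for d
    proof -
      have "int d dvd ?n" using that j by auto
      hence "int d \<le> \<bar>?n\<bar>" using n by (metis dvd_imp_le_int abs_of_nat)
      thus ?thesis by simp
    qed
    show "finite ?D" by (rule finite_subset[of _ "{..nat \<bar>?n\<bar>}"]) (use le in auto)
    have "?n dvd fst (quotient_of (a i))" if "i \<in> {1..s}" for i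
      using a[OF that] quotient_of_numerator_dvd by auto
    thus "nat \<bar>?n\<bar> \<in> ?D" using n p by simp
  qed
  moreover have "\<not> (\<forall>j\<in>{1..s}. a j = 0)" using j by auto
  ultimately show ?thesis unfolding coprime_content_def by (simp only: if_False)
qed

section \<open>One component of the map\<close>

lemma padic_p_multiple_mult:
  "x \<in> (*) padic_p ` padic_ints \<Longrightarrow> y \<in> padic_ints \<Longrightarrow> x * y \<in> (*) padic_p ` padic_ints"
  by (auto simp: mult.assoc intro!: imageI padic_ints_mult)

lemma padic_p_multiple_padic_ints: "x \<in> (*) padic_p ` padic_ints \<Longrightarrow> x \<in> padic_ints"
  by (auto intro!: padic_ints_mult)

lemma inverse_of_int_padic_ints:
  "\<not> int CARD('p) dvd a \<Longrightarrow> inverse (of_int a :: 'p::prime_card padic) \<in> padic_ints"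
  using inverse_padic_ints(2)[of 0 a] padic_ints_of_nat[of 0] by (auto simp: image_iff)

text \<open>This treats both components at once, with \<open>(A, B)\<close> equal to
  \<open>(a1, 1)\<close> or \<open>(1, 0)\<close>. Reduce \<open>m / e\<close> to
  \<open>n / q\<close>: the content is the absolute value of \<open>n\<close>, the bracket removes
  the rational coordinate, and only a divisor of \<open>e\<close> remains as denominator.\<close>

lemma normalised_coordinates:
  fixes z y :: "'p::prime_card padic" and m e A B :: int
  assumes min: "is_min_poly f z" "degree f = 3" and z: "z \<in> (*) padic_p ` padic_ints"
    and m: "\<not> int CARD('p) dvd m" and e: "\<not> int CARD('p) dvd e" and AB: "A = 1 \<or> B = 1"
    and y: "y = of_rat r0 + of_int m / of_int e * (of_int A * z + of_int B * z ^ 2)" "y \<in> padic_ints"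
    and g: "g = y - of_nat (padic_omega y)"
    and a: "a = z_coords 2 z g" and c: "c = coprime_content CARD('p) 2 a"
  shows "\<exists>d. d dvd e \<and>
    g / of_nat c - padic_bracket (of_rat (a 0 / of_nat c)) = (of_int A * z + of_int B * z ^ 2) / of_int d"
proof -
  let ?Z = "of_int A * z + of_int B * z ^ 2"
  have "m \<noteq> 0" "e \<noteq> 0" using m e by auto
  define r :: rat where "r = of_int m / of_int e"
  have r: "r \<noteq> 0" "(of_rat r :: 'p padic) = of_int m / of_int e"
    using \<open>m \<noteq> 0\<close> \<open>e \<noteq> 0\<close> by (simp_all add: r_def of_rat_divide)
  obtain n q where nq: "quotient_of r = (n, q)" by (metis surj_pair)
  have rnq: "r = of_int n / of_int q" and "q > 0" and cop: "coprime n q"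
    using nq by (auto intro: quotient_of_div quotient_of_denom_pos quotient_of_coprime)
  have "(of_int (n * e) :: rat) = of_int (m * q)"
    using rnq \<open>e \<noteq> 0\<close> \<open>q > 0\<close> by (simp add: r_def field_simps)
  hence ne: "n * e = m * q" by (simp only: of_int_eq_iff)
  hence "n \<noteq> 0" using \<open>m \<noteq> 0\<close> \<open>q > 0\<close> by auto
  have "n dvd m" using ne cop by (metis coprime_dvd_mult_left_iff dvd_triv_left)
  hence pn: "\<not> int CARD('p) dvd \<bar>n\<bar>" using m dvd_trans by auto
  have "q dvd e" using ne cop by (metis coprime_commute coprime_dvd_mult_right_iff dvd_triv_right)

  \<comment> \<open>The leading digit is an integer, so subtracting it changes only the coordinate
    of index 0.\<close>
  define b where "b = (\<lambda>j::nat. if j = 0 then r0 - of_nat (padic_omega y)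
    else if j = 1 then of_int A * r else if j = 2 then of_int B * r else 0)"
  have gb: "g = of_rat (b 0) + of_int m / of_int e * ?Z"
    by (simp add: g y(1) b_def of_rat_diff)
  have "a = b"
    unfolding a
  proof (rule z_coords_eqI[OF min(1)])
    have "of_rat (b 1) = of_int A * (of_int m / of_int e :: 'p padic)"
      "of_rat (b 2) = of_int B * (of_int m / of_int e :: 'p padic)"
      by (simp_all add: b_def of_rat_mult r(2))
    thus "g = (\<Sum>j\<le>2. of_rat (b j) * z ^ j)"
      by (simp add: gb numeral_2_eq_2 algebra_simps add_divide_distrib)
    show "degree f = Suc 2" using min by simp
  qed (simp add: b_def)
  have "c = nat \<bar>n\<bar>"
  proof -
    \<comment> \<open>By \<open>AB\<close> one of the two coordinates is \<open>r\<close> itself,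
      which the content computation requires.\<close>
    define j :: nat where "j = (if A = 1 then 1 else 2)"
    have "\<not> CARD('p) dvd nat \<bar>n\<bar>" using pn by (simp flip: int_dvd_int_iff)
    hence "coprime CARD('p) (nat \<bar>n\<bar>)" using prime_card by (intro prime_imp_coprime)
    hence "coprime (nat \<bar>fst (quotient_of r)\<bar>) CARD('p)"
      using nq coprime_commute by (metis fst_conv)
    moreover have "\<exists>m. b i = of_int m * r" if "i \<in> {1..2}" for i
      using that by (auto simp: b_def)
    moreover have "j \<in> {1..2}" "b j = r" using AB by (auto simp: j_def b_def)
    ultimately have "coprime_content CARD('p) 2 b = nat \<bar>fst (quotient_of r)\<bar>"
      using r(1) by (intro coprime_content_eq_numerator)
    thus ?thesis by (simp add: c \<open>a = b\<close> nq)
  qed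
  hence cn: "(of_nat c :: 'p padic) = of_int \<bar>n\<bar>" by simp

  have zi: "z \<in> padic_ints" using z by (rule padic_p_multiple_padic_ints)
  \<comment> \<open>The factor \<open>z\<close> makes the irrational part of \<open>g\<close> a
    multiple of \<open>p\<close>. As \<open>g\<close> is one too, so is the rational coordinate
    \<open>b 0\<close>, also after division by \<open>n\<close>, and the bracket fixes it.\<close>
  have "?Z = z * (of_int A + of_int B * z)" by (simp add: power2_eq_square algebra_simps)
  also have "\<dots> * (of_int m * inverse (of_int e)) \<in> (*) padic_p ` padic_ints"
    by (intro padic_p_multiple_mult z padic_ints_intros zi inverse_of_int_padic_ints e)
  finally have "of_int m / of_int e * ?Z \<in> (*) padic_p ` padic_ints"
    by (simp add: field_simps)
  moreover have "g \<in> (*) padic_p ` padic_ints" unfolding g using y(2) by (rule diff_padic_omega)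
  ultimately have "g - of_int m / of_int e * ?Z \<in> (*) padic_p ` padic_ints"
    using padic_p_multiple_diff[of _ 1] by simp
  hence "of_rat (b 0) \<in> (*) padic_p ` (padic_ints :: 'p padic set)" by (simp add: gb)
  hence "of_rat (b 0) * inverse (of_int \<bar>n\<bar>) \<in> (*) padic_p ` (padic_ints :: 'p padic set)"
    by (intro padic_p_multiple_mult inverse_of_int_padic_ints pn)
  hence "padic_bracket (of_rat (a 0 / of_nat c) :: 'p padic) = of_rat (b 0) / of_int \<bar>n\<bar>"
    using \<open>a = b\<close> cn by (simp add: of_rat_divide padic_bracket_ident flip: divide_inverse)
  hence "g / of_nat c - padic_bracket (of_rat (a 0 / of_nat c)) = of_rat r / of_int \<bar>n\<bar> * ?Z"
    by (simp add: gb cn r(2) add_divide_distrib)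
  \<comment> \<open>The content is positive, so the sign of \<open>n\<close> is left over; it is
    absorbed into the denominator, which may be negative.\<close>
  also have "(of_rat r / of_int \<bar>n\<bar> :: 'p padic) = 1 / of_int (sgn n * q)"
    using \<open>n \<noteq> 0\<close> \<open>q > 0\<close> by (cases "n > 0") (simp_all add: rnq of_rat_divide)
  finally have "g / of_nat c - padic_bracket (of_rat (a 0 / of_nat c)) = ?Z / of_int (sgn n * q)"
    by simp
  moreover have "sgn n * q dvd e" using \<open>q dvd e\<close> \<open>n \<noteq> 0\<close> by (cases "n > 0") auto
  ultimately show ?thesis by blast
qed

section \<open>One step of the map\<close>

text \<open>The integer \<open>b\<close> is free and enters only the rational coordinate of the
  second quotient, so the result has the same shape for every \<open>b\<close>. The cyclic shift
  puts the quotient formed from \<open>\<alpha>2\<close> first.\<close>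

lemma phi_map_step:
  fixes z :: "'p::prime_card padic" and a1 a2 a3 b d e \<epsilon> :: int
  assumes min: "is_min_poly [:of_int (a3 * int CARD('p) ^ k), of_int a2, of_int a1, 1:] z"
    and z: "z \<in> (*) padic_p ` padic_ints"
    and a2: "\<not> int CARD('p) dvd a2" and a3: "\<not> int CARD('p) dvd a3"
    and \<epsilon>: "\<epsilon> \<in> {-1, 1}" and d: "d dvd a3" and e: "e dvd a3"
  shows "\<exists>d' e'. d' dvd a3 \<and> e' dvd a3 \<and>
    phi_map \<epsilon> z [z / of_int d, (z ^ 2 + of_int b * z) / of_int e]
      = [z / of_int d', (z ^ 2 + of_int a1 * z) / of_int e']"
proof -
  let ?P = "padic_p :: 'p padic"
  define Q where "Q = z ^ 2 + of_int a1 * z + of_int a2"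
  define \<alpha>1 where "\<alpha>1 = z / of_int d"
  define \<alpha>2 where "\<alpha>2 = (z ^ 2 + of_int b * z) / of_int e"
  have pd: "\<not> int CARD('p) dvd d" and pe: "\<not> int CARD('p) dvd e"
    using a3 d e dvd_trans by blast+
  have nz: "(of_int d :: 'p padic) \<noteq> 0" "(of_int e :: 'p padic) \<noteq> 0" "(of_int a3 :: 'p padic) \<noteq> 0"
    using pd pe a3 by auto
  have zi: "z \<in> padic_ints" using z by (rule padic_p_multiple_padic_ints)
  note ints = padic_ints_intros zi inverse_of_int_padic_ints a3 pd pe
  have root: "z * Q = - (of_int a3 * ?P ^ k)"
    using min by (simp add: is_min_poly_def Q_def map_poly_pCons algebra_simps power2_eq_square
        of_rat_mult of_rat_power eq_neg_iff_add_eq_0)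
  have "z * (z + of_int a1) \<in> (*) ?P ` padic_ints"
    by (intro padic_p_multiple_mult z ints)
  from inverse_padic_ints[OF this a2] have Q: "Q \<noteq> 0" "inverse Q \<in> padic_ints"
    by (simp_all add: Q_def power2_eq_square algebra_simps)
  have Qi: "Q \<in> padic_ints" unfolding Q_def by (intro ints)
  \<comment> \<open>Since \<open>a3\<close> and \<open>Q\<close> are units, this displays
    \<open>z\<close> as \<open>p ^ k\<close> times a unit, from which both orders below are read
    off.\<close>
  have z_eq: "z = ?P ^ k * (- of_int a3 * inverse Q)"
    using root Q(1) by (simp add: field_simps)
  have "z \<noteq> 0" using root nz by auto
  have P_eq: "?P ^ k / z = - Q / of_int a3"
    using root nz \<open>z \<noteq> 0\<close> by (simp add: field_simps)

  have \<alpha>1: "\<alpha>1 = ?P ^ k * (- of_int a3 * inverse Q * inverse (of_int d))"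
    unfolding \<alpha>1_def by (subst z_eq) (simp add: divide_inverse)
  have ord1: "padic_ord \<alpha>1 = Fin (int k)"
    unfolding \<alpha>1
  proof (rule padic_ord_unit_mult)
    show "- of_int a3 * inverse Q * inverse (of_int d) \<in> (padic_ints :: 'p padic set)"
      by (intro ints Q)
    have "- (Q * of_int d * inverse (of_int a3)) \<in> (padic_ints :: 'p padic set)"
      by (intro ints Qi)
    thus "inverse (- of_int a3 * inverse Q * inverse (of_int d)) \<in> (padic_ints :: 'p padic set)"
      by (simp add: field_simps)
  qed (use nz Q in simp)
  \<comment> \<open>As \<open>\<alpha>2\<close> is \<open>z\<close> times a p-adic integer, its
    order is at least \<open>k\<close>, or infinite if it vanishes; either way the second quotient
    receives no power of \<open>p\<close>.\<close>
  have max0: "max (padic_ord \<alpha>1 - padic_ord \<alpha>2) 0 = 0"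
  proof (cases "\<alpha>2 = 0")
    case True
    hence "padic_ord \<alpha>2 = Pinf" by (simp add: padic_ord_def)
    thus ?thesis by (simp add: ord1 zero_extended_def)
  next
    case False
    have "\<alpha>2 = z * ((z + of_int b) * inverse (of_int e))"
      by (simp add: \<alpha>2_def power2_eq_square field_simps)
    also have "\<dots> = ?P ^ k * (- of_int a3 * inverse Q * ((z + of_int b) * inverse (of_int e)))"
      by (subst z_eq) simp
    also have "\<dots> \<in> (*) (?P ^ k) ` padic_ints" by (intro imageI ints Q)
    finally obtain m where "m \<ge> int k" "padic_ord \<alpha>2 = Fin m" using False padic_ord_ge by metis
    thus ?thesis by (simp add: ord1 zero_extended_def)
  qed
  have deg: "degree [:of_int (a3 * int CARD('p) ^ k), of_int a2, of_int a1, 1 :: rat:] = 3" by simp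
  have nz1: "\<alpha>1 \<noteq> 0" using \<open>z \<noteq> 0\<close> nz by (simp add: \<alpha>1_def)
  have "\<exists>e'. e' dvd a3 \<and> phi_h \<epsilon> z [\<alpha>1, \<alpha>2] 0 = (of_int a1 * z + of_int 1 * z ^ 2) / of_int e'"
  proof -
    let ?y = "of_int \<epsilon> * padic_p_pow (padic_ord \<alpha>1) / \<alpha>1"
    have y_eq: "?y = - (of_int \<epsilon> * of_int d) * Q * inverse (of_int a3)"
    proof -
      have "?y = of_int \<epsilon> * of_int d * (?P ^ k / z)"
        unfolding ord1 by (simp add: \<alpha>1_def)
      thus ?thesis unfolding P_eq by (simp add: field_simps)
    qed
    have y: "?y = of_rat (of_int (- \<epsilon> * d * a2) / of_int a3)
        + of_int (- \<epsilon> * d) / of_int a3 * (of_int a1 * z + of_int 1 * z ^ 2)"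
      using nz unfolding y_eq Q_def by (simp add: of_rat_divide of_rat_mult of_rat_minus field_simps)
    have yi: "?y \<in> padic_ints" unfolding y_eq by (intro ints Qi)
    have pm: "\<not> int CARD('p) dvd - \<epsilon> * d" using pd \<epsilon> by auto
    have g: "phi_g \<epsilon> [\<alpha>1, \<alpha>2] 0 = ?y - of_nat (padic_omega ?y)"
      using nz1 by (simp add: phi_g_def Let_def)
    from normalised_coordinates[OF min deg z pm a3 _ y yi g refl refl]
    show ?thesis unfolding phi_h_def Let_def by (simp add: numeral_2_eq_2)
  qed
  moreover have "\<exists>d'. d' dvd a3 \<and> phi_h \<epsilon> z [\<alpha>1, \<alpha>2] 1 = (of_int 1 * z + of_int 0 * z ^ 2) / of_int d'"
  proof -
    let ?y = "of_int \<epsilon> * padic_p_pow (max (padic_ord \<alpha>1 - padic_ord \<alpha>2) 0) * \<alpha>2 / \<alpha>1"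
    have y_eq: "?y = of_int \<epsilon> * of_int d * (z + of_int b) * inverse (of_int e)"
      unfolding max0 using \<open>z \<noteq> 0\<close> nz
      by (simp add: \<alpha>1_def \<alpha>2_def zero_extended_def power2_eq_square field_simps)
    have y: "?y = of_rat (of_int (\<epsilon> * d * b) / of_int e)
        + of_int (\<epsilon> * d) / of_int e * (of_int 1 * z + of_int 0 * z ^ 2)"
      using nz unfolding y_eq by (simp add: of_rat_divide of_rat_mult field_simps)
    have yi: "?y \<in> padic_ints" unfolding y_eq by (intro ints)
    have pm: "\<not> int CARD('p) dvd \<epsilon> * d" using pd \<epsilon> by auto
    have g: "phi_g \<epsilon> [\<alpha>1, \<alpha>2] 1 = ?y - of_nat (padic_omega ?y)"
      using nz1 by (simp add: phi_g_def Let_def)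
    from normalised_coordinates[OF min deg z pm pe _ y yi g refl refl] e
    \<comment> \<open>The denominator produced here divides \<open>e\<close>, and so divides
      \<open>a3\<close>.\<close>
    show ?thesis unfolding phi_h_def Let_def by (auto simp: numeral_2_eq_2 intro: dvd_trans)
  qed
  ultimately obtain d' e' where "d' dvd a3" "e' dvd a3"
    "phi_h \<epsilon> z [\<alpha>1, \<alpha>2] 0 = (z ^ 2 + of_int a1 * z) / of_int e'"
    "phi_h \<epsilon> z [\<alpha>1, \<alpha>2] 1 = z / of_int d'" by (auto simp: add.commute)
  thus ?thesis
    by (intro exI[of _ d'] exI[of _ e']) (simp add: phi_map_def \<alpha>1_def[symmetric] \<alpha>2_def[symmetric])
qed

section \<open>Periodicity\<close>

text \<open>Pigeonhole on the orbit from \<open>f x\<close> onwards. Only \<open>f x\<close> is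
  required to lie in \<open>S\<close>, because \<open>[z, z ^ 2]\<close> is in general not one of
  the recurring states.\<close>

lemma funpow_eventually_repeats:
  assumes "finite S" "f x \<in> S" "\<And>y. y \<in> S \<Longrightarrow> f y \<in> S"
  shows "\<exists>m n. m < n \<and> (f ^^ m) x = (f ^^ n) x"
proof -
  have "(f ^^ Suc n) x \<in> S" for n by (induction n) (use assms in auto)
  hence "range (\<lambda>n. (f ^^ Suc n) x) \<subseteq> S" by auto
  hence "\<not> inj (\<lambda>n. (f ^^ Suc n) x)"
    using assms(1) finite_subset range_inj_infinite by blast
  then obtain m n where "m \<noteq> n" "(f ^^ Suc m) x = (f ^^ Suc n) x" by (auto simp: inj_def)
  thus ?thesis by (metis linorder_neqE_nat Suc_less_eq)
qed

theorem theorem4: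
  fixes K :: "'p::prime_card padic set" and z :: "'p padic"
    and a1 a2 a3 \<epsilon> :: int and k :: nat
  assumes "subfield_set K" and "rat_vs.dim K = 3"
    and "z \<in> K" and "condition_H z" and "K = rat_adjoin z" and "algebraic_int z"
    and "is_min_poly [:of_int (a3 * int CARD('p) ^ k), of_int a2, of_int a1, 1:] z"
    and "padic_ord (of_int a2 :: 'p padic) = 0" and "padic_ord (of_int a3 :: 'p padic) = 0"
    and "k > 0"
    and "\<epsilon> \<in> {-1, 1}"
  shows "\<exists>m1 m2. m1 < m2 \<and> (phi_map \<epsilon> z ^^ m1) [z, z ^ 2] = (phi_map \<epsilon> z ^^ m2) [z, z ^ 2]"
proof -
  define F where "F = (\<lambda>(d, e). [z / of_int d, (z ^ 2 + of_int a1 * z) / of_int e]) `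
    ({d. d dvd a3} \<times> {e. e dvd a3})"
  have a2: "\<not> int CARD('p) dvd a2" and a3: "\<not> int CARD('p) dvd a3"
    using assms by (auto dest: padic_ord_of_int_eq_0D)
  have z: "z \<in> (*) padic_p ` padic_ints" using assms by (simp add: condition_H_def)
  \<comment> \<open>\<open>b\<close> stays free: 0 serves the first step and \<open>a1\<close> all
    later ones.\<close>
  have step: "phi_map \<epsilon> z [z / of_int d, (z ^ 2 + of_int b * z) / of_int e] \<in> F"
    if "d dvd a3" "e dvd a3" for b d e
    using phi_map_step[OF assms(7) z a2 a3 assms(11) that, of b] by (auto simp: F_def)
  show ?thesis
  proof (rule funpow_eventually_repeats)
    have "a3 \<noteq> 0" using a3 by auto
    thus "finite F" by (simp add: F_def)
    show "phi_map \<epsilon> z [z, z ^ 2] \<in> F" using step[of 1 1 0] by simp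
    show "phi_map \<epsilon> z v \<in> F" if "v \<in> F" for v using that step by (auto simp: F_def)
  qed
qed

end
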